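(* Let $a,b\geq 2$ be integers and write $a+b=tb^2+\epsilon$ with integers $t\ge 0$ and $0\le\epsilon\le b^2-1$. Then there is a unique smooth arithmetical structure on $D_n$ with $\bar r_x=a$ and $\bar r_y=b$ if $n=F(b^2,\epsilon)+t+\left\lfloor \frac{ab}{a+b}\right\rfloor$, and there is no such structure on $D_n$ for any other $n$.
   Context: For $n\ge 3$ let $\ell=n-3$. The bident $D_n$ has vertices $v_x,v_y,v_0,\dots,v_\ell$ and edges $v_xv_0$, $v_yv_0$, $v_iv_{i+1}$ ($0\le i\le\ell-1$). An arithmetical structure on $D_n$ is a pair $(\mathbf d,\mathbf r)$, $\mathbf d=(d_x,d_y,d_0,\dots,d_\ell)$, $\mathbf r=(r_x,r_y,r_0,\dots,r_\ell)$, of positive integer vectors with $(\operatorname{diag}(\mathbf d)-A)\mathbf r=\mathbf 0$ ($A$ the adjacency matrix) and $\mathbf r$ primitive. It is smooth if $d_x,d_y,d_1,\dots,d_\ell\ge2$. For such a structure set $\bar{\mathbf r}=\frac{r_0}{r_xr_y}\mathbf r$ (an integer vector with $\bar r_x\bar r_y=\bar r_0$). The function $F:\mathbb Z_{>0}\times\mathbb Z_{\ge0}\to\mathbb Z_{>0}$ is defined as follows: given $x_1>0$, $x_2\ge0$, for each $i\ge 2$ with $x_i>0$ let $x_{i+1}$ be the least nonnegative residue of $-x_{i-1}$ modulo $x_i$; $F(x_1,x_2)$ is the number of positive terms of $(x_i)$ (so $F(x,0)=1$). *)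

theory Defs
  imports "Jordan_Normal_Form.Matrix"
begin

text \<open>
  Vertices of the bident on \<open>n\<close> vertices are the indices \<open>0, \<dots>, n - 1\<close>, in the order
  \<open>v\<^sub>x, v\<^sub>y, v\<^sub>0, \<dots>, v\<^sub>\<ell>\<close> with \<open>\<ell> = n - 3\<close>.
\<close>

abbreviation vx :: nat where "vx \<equiv> 0"

abbreviation vy :: nat where "vy \<equiv> 1"

abbreviation vpath :: "nat \<Rightarrow> nat" where "vpath i \<equiv> i + 2"

definition bident_edges :: "nat \<Rightarrow> nat set set" where
  "bident_edges n =
     {{vx, vpath 0}, {vy, vpath 0}} \<union> {{vpath i, vpath (i + 1)} | i. i + 1 \<le> n - 3}"

definition bident_adj :: "nat \<Rightarrow> int mat" where
  "bident_adj n = mat n n (\<lambda>(i, j). if {i, j} \<in> bident_edges n then 1 else 0)"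

definition bident_arith_structure :: "nat \<Rightarrow> int vec \<Rightarrow> int vec \<Rightarrow> bool" where
  "bident_arith_structure n d r \<longleftrightarrow>
     n \<ge> 3 \<and> d \<in> carrier_vec n \<and> r \<in> carrier_vec n \<and>
     (\<forall>i<n. d $ i > 0) \<and> (\<forall>i<n. r $ i > 0) \<and>
     (mat_diag n (\<lambda>i. d $ i) - bident_adj n) *\<^sub>v r = 0\<^sub>v n \<and>
     Gcd (vec_set r) = 1"

definition smooth_bident_arith_structure :: "nat \<Rightarrow> int vec \<Rightarrow> int vec \<Rightarrow> bool" where
  "smooth_bident_arith_structure n d r \<longleftrightarrow>
     bident_arith_structure n d r \<and>
     d $ vx \<ge> 2 \<and> d $ vy \<ge> 2 \<and> (\<forall>i\<in>{1..n - 3}. d $ vpath i \<ge> 2)"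

definition rbar :: "int vec \<Rightarrow> rat vec" where
  "rbar r = (of_int (r $ vpath 0) / (of_int (r $ vx) * of_int (r $ vy))) \<cdot>\<^sub>v map_vec of_int r"

text \<open>
  The term with index \<open>i\<close> is \<open>x\<^bsub>i+1\<^esub>\<close>. After its first zero the sequence is continued by
  zeros, which do not contribute to the number of positive terms.
\<close>

fun residue_seq :: "int \<Rightarrow> int \<Rightarrow> nat \<Rightarrow> int" where
  "residue_seq x1 x2 0 = x1"
| "residue_seq x1 x2 (Suc 0) = x2"
| "residue_seq x1 x2 (Suc (Suc i)) =
     (if residue_seq x1 x2 (Suc i) > 0
      then (- residue_seq x1 x2 i) mod residue_seq x1 x2 (Suc i) else 0)"

definition F :: "int \<Rightarrow> int \<Rightarrow> nat" where
  "F x1 x2 = card {i. residue_seq x1 x2 i > 0}"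

end

theory Submission
  imports Defs
begin

text \<open>
  Smoothness makes the entries of \<open>r\<close> strictly decrease along the path, so every entry of
  \<open>rbar\<close> is determined by the two before it as a least nonnegative residue. Since
  \<open>0 < a + b \<le> a b\<close>, the centre has \<open>d\<^sub>0 = 1\<close> and the path carries the residue
  sequence starting with \<open>a b, a b - a - b\<close>; hence \<open>n = F(a b, a b - a - b) + 2\<close>.
  With \<open>s = a + b\<close> this sequence first descends in steps of \<open>s\<close> to \<open>a b mod s\<close>, which is
  \<open>-b\<^sup>2 mod s\<close> because \<open>a \<equiv> -b\<close> modulo \<open>s\<close>. This gives
  \<open>n = F(b\<^sup>2, s) + \<lfloor>a b / s\<rfloor>\<close>, and \<open>F(x, y + x) = F(x, y) + 1\<close> removes the \<open>t\<close> copies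
  of \<open>b\<^sup>2\<close> from \<open>s\<close>.
\<close>

section \<open>Residue sequences and the counting function \<open>F\<close>\<close>

lemma residue_seq_Suc:
  assumes "0 < y"
  shows "residue_seq x y (Suc i) = residue_seq y ((- x) mod y) i"
  using assms by (induction y "(- x) mod y" i rule: residue_seq.induct) auto

lemma residue_seq_0_eq_0: "residue_seq x 0 (Suc i) = 0"
  by (induction i) auto

lemma residue_seq_pos_split:
  assumes "0 < x" "0 < y"
  shows "{i. 0 < residue_seq x y i} = insert 0 (Suc ` {i. 0 < residue_seq y ((- x) mod y) i})"
proof (rule Set.set_eqI)
  fix i
  show "i \<in> {i. 0 < residue_seq x y i} \<longleftrightarrow>
        i \<in> insert 0 (Suc ` {i. 0 < residue_seq y ((- x) mod y) i})"
    using assms by (cases i) (auto simp: residue_seq_Suc simp del: residue_seq.simps(3))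
qed

lemma residue_seq_0_pos: "0 < x \<Longrightarrow> {i. 0 < residue_seq x 0 i} = {0}"
proof (rule Set.set_eqI)
  fix i assume "0 < x"
  then show "i \<in> {i. 0 < residue_seq x 0 i} \<longleftrightarrow> i \<in> {0}"
    by (cases i) (auto simp: residue_seq_0_eq_0 simp del: residue_seq.simps(3))
qed

text \<open>Each step replaces the second argument by a smaller nonnegative residue, so induction on
  it shows that the positive terms form a finite initial segment. \<open>F\<close> is then the index
  of the first zero.\<close>

lemma residue_seq_pos_eq_lessThan:
  assumes "0 < x" "0 \<le> y"
  shows "{i. 0 < residue_seq x y i} = {..<F x y}"
proof -
  have "\<exists>N. {i. 0 < residue_seq x y i} = {..<N}"
    using assms
  proof (induction "nat y" arbitrary: x y rule: less_induct)
    case less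
    show ?case
    proof (cases "y = 0")
      case True
      then show ?thesis using less.prems residue_seq_0_pos lessThan_Suc[of 0] by auto
    next
      case False
      with less.prems have "0 < y" by simp
      then obtain N where "{i. 0 < residue_seq y ((- x) mod y) i} = {..<N}"
        using less.hyps[of "(- x) mod y" y] by auto
      then have "{i. 0 < residue_seq x y i} = {..<Suc N}"
        using residue_seq_pos_split[OF less.prems(1) \<open>0 < y\<close>] lessThan_Suc_eq_insert_0 by metis
      then show ?thesis by blast
    qed
  qed
  then obtain N where N: "{i. 0 < residue_seq x y i} = {..<N}" by blast
  show ?thesis unfolding F_def N card_lessThan by (rule refl)
qed

lemma residue_seq_pos_iff:
  assumes "0 < x" "0 \<le> y"
  shows "0 < residue_seq x y i \<longleftrightarrow> i < F x y"
  using residue_seq_pos_eq_lessThan[OF assms] by blast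

lemma F_0: "0 < x \<Longrightarrow> F x 0 = 1"
  by (simp add: F_def residue_seq_0_pos)

text \<open>Turns the cardinality into a Euclid-like recursion. Together with \<open>F_0\<close> it
  carries all later evaluations of \<open>F\<close>.\<close>

lemma F_rec:
  assumes "0 < x" "0 < y"
  shows "F x y = Suc (F y ((- x) mod y))"
proof -
  \<comment> \<open>\<open>card\<close> registers the inserted index 0 only because the set is
    finite.\<close>
  have "finite {i. 0 < residue_seq y ((- x) mod y) i}"
    using residue_seq_pos_eq_lessThan[of y "(- x) mod y"] assms by simp
  then show ?thesis
    unfolding F_def residue_seq_pos_split[OF assms] by (simp add: card_image)
qed

text \<open>The first argument contributes one term and otherwise enters only through its negative
  modulo the second.\<close>

lemma F_mod_left:
  assumes "0 < x" "0 < x'" "0 \<le> y" "x mod y = x' mod y"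
  shows "F x y = F x' y"
proof -
  have "(- x) mod y = (- x') mod y" using assms(4) mod_minus_cong by blast
  then show ?thesis using assms(1-3) F_0[of x] F_0[of x'] F_rec[of x y] F_rec[of x' y]
    by (cases "y = 0") auto
qed

text \<open>One step leads from the pair \<open>x, y + x\<close> to the pair
  \<open>y + x, y\<close>, and modulo \<open>y\<close> the first entry may be replaced by
  \<open>x\<close>.\<close>

lemma F_add_right:
  assumes "0 < x" "0 \<le> y"
  shows "F x (y + x) = Suc (F x y)"
proof (cases "y = 0")
  case True
  then show ?thesis using assms F_rec[of x x] F_0[of x] by simp
next
  case False
  have "(- x) mod (y + x) = (- x + (y + x)) mod (y + x)" by (rule mod_add_self2[symmetric])
  then have "(- x) mod (y + x) = y" using assms False by simp
  moreover have "F (y + x) y = F x y" using assms by (intro F_mod_left) auto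
  ultimately show ?thesis using assms False F_rec[of x "y + x"] by simp
qed

lemma F_add_mult_right:
  assumes "0 < x" "0 \<le> y"
  shows "F x (y + int k * x) = F x y + k"
proof (induction k)
  case (Suc k)
  have "y + int (Suc k) * x = (y + int k * x) + x" by (simp add: algebra_simps)
  then show ?case using F_add_right[of x "y + int k * x"] Suc assms by (simp only: add_Suc_right) simp
qed simp

text \<open>In an arithmetic progression the sum of two outer neighbours is twice the middle term.
  Hence the residue sequence runs down the progression, and each step of length \<open>s\<close>
  adds one term.\<close>

lemma F_arith_progression:
  assumes "0 < s" "0 \<le> y"
  shows "F (y + int k * s + s) (y + int k * s) = F (y + s) y + k"
proof (induction k)
  case (Suc k)
  have "0 \<le> y + int k * s" using assms by simp
  moreover have "(- (y + int (Suc k) * s + s)) mod (y + int (Suc k) * s) = y + int k * s"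
  proof -
    have "- (y + int (Suc k) * s + s) = (y + int k * s) + (y + int (Suc k) * s) * (- 2)"
      by (simp add: algebra_simps)
    then have "(- (y + int (Suc k) * s + s)) mod (y + int (Suc k) * s)
        = (y + int k * s) mod (y + int (Suc k) * s)"
      by (metis mod_mult_self2)
    then show ?thesis using assms \<open>0 \<le> y + int k * s\<close> by (simp add: algebra_simps)
  qed
  moreover have "0 < y + int (Suc k) * s" using assms by (simp add: add_nonneg_pos)
  ultimately have "F (y + int (Suc k) * s + s) (y + int (Suc k) * s)
      = Suc (F (y + int (Suc k) * s) (y + int k * s))"
    using F_rec[of "y + int (Suc k) * s + s" "y + int (Suc k) * s"] assms by simp
  moreover have "F (y + int (Suc k) * s) (y + int k * s) = F (y + s) y + k"
    using Suc by (simp add: algebra_simps)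
  ultimately show ?case by simp
qed simp

text \<open>This is \<open>(a - 1) * (b - 1) \<ge> 1\<close>, expanded. It makes the second residue
  term \<open>a * b - a - b\<close> nonnegative and later forces the coefficient at the centre to be
  1.\<close>

lemma add_le_mult_int: "(2::int) \<le> a \<Longrightarrow> 2 \<le> b \<Longrightarrow> a + b \<le> a * b"
  using mult_mono[of 1 "a - 1" 1 "b - 1"] by (simp add: algebra_simps)

lemma F_mult_diff_add:
  fixes a b :: int
  assumes "2 \<le> a" "2 \<le> b"
  shows "int (F (a * b) (a * b - a - b)) + 2 = int (F (b\<^sup>2) (a + b)) + a * b div (a + b)"
proof -
  \<comment> \<open>\<open>k\<close> is one less than the quotient because the sequence starts with
    the pair \<open>\<rho> + k * s + s\<close>, \<open>\<rho> + k * s\<close>. The quotient is at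
    least 1, so \<open>nat\<close> truncates nothing.\<close>
  define s \<rho> k where "s = a + b" and "\<rho> = a * b mod s" and "k = nat (a * b div s - 1)"
  have s: "0 < s" "s \<le> a * b" using assms add_le_mult_int unfolding s_def by auto
  have q: "1 \<le> a * b div s" using s by (simp add: pos_imp_zdiv_pos_iff int_one_le_iff_zero_less)
  have k: "int k = a * b div s - 1" using q unfolding k_def by simp
  have ab: "a * b = \<rho> + int k * s + s"
  proof -
    have "a * b = \<rho> + (int k + 1) * s" unfolding k \<rho>_def using mod_mult_div_eq[of "a*b" s]
      by (simp add: mult.commute)
    then show ?thesis by (simp add: algebra_simps)
  qed
  have \<rho>: "0 \<le> \<rho>" "\<rho> < s" using s unfolding \<rho>_def by auto
  \<comment> \<open>Substituting \<open>a = s - b\<close> removes \<open>a\<close> from the residue,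
    so \<open>\<rho>\<close> is also the successor of \<open>s\<close> in the sequence that starts
    with \<open>b\<^sup>2, s\<close>.\<close>
  have \<rho>': "\<rho> = (- b\<^sup>2) mod s"
  proof -
    have "a * b = - b\<^sup>2 + b * s" unfolding s_def by (simp add: algebra_simps power2_eq_square)
    then show ?thesis unfolding \<rho>_def by (metis mod_mult_self1)
  qed
  have "F (a * b) (a * b - a - b) = F (\<rho> + s) \<rho> + k"
    using F_arith_progression[of s \<rho> k] \<rho> s ab unfolding s_def by (simp add: algebra_simps)
  \<comment> \<open>At the bottom of the descent the first entry drops to \<open>s\<close>; reading
    \<open>F_rec\<close> backwards then puts \<open>b\<^sup>2\<close> in front.\<close>
  moreover have "F (\<rho> + s) \<rho> = F s \<rho>" using \<rho> s by (intro F_mod_left) auto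
  moreover have "Suc (F s \<rho>) = F (b\<^sup>2) s" using F_rec[of "b\<^sup>2" s] s assms \<rho>' by simp
  ultimately have "int (F (a * b) (a * b - a - b)) + 1 = int (F (b\<^sup>2) s) + int k" by linarith
  then show ?thesis using k unfolding s_def by simp
qed

section \<open>The kernel equations of the bident\<close>

lemma mult_mat_vec_bident:
  assumes "3 \<le> n" "d \<in> carrier_vec n" "r \<in> carrier_vec n" "i < n"
  shows "((mat_diag n (\<lambda>i. d $ i) - bident_adj n) *\<^sub>v r) $ i
    = d $ i * r $ i - (\<Sum>j | j < n \<and> {i, j} \<in> bident_edges n. r $ j)"
proof -
  have "((mat_diag n (\<lambda>i. d $ i) - bident_adj n) *\<^sub>v r) $ i
     = (\<Sum>j<n. (if j = i then d $ i * r $ i else 0)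
              - (if {i, j} \<in> bident_edges n then r $ j else 0))"
    using assms unfolding mat_diag_def bident_adj_def
    by (auto simp: scalar_prod_def atLeast0LessThan intro!: sum.cong)
       (auto simp: algebra_simps)
  also have "\<dots> = d $ i * r $ i - (\<Sum>j<n. if {i, j} \<in> bident_edges n then r $ j else 0)"
    using assms by (simp add: sum_subtractf)
  also have "(\<Sum>j<n. if {i, j} \<in> bident_edges n then r $ j else 0)
     = (\<Sum>j | j < n \<and> {i, j} \<in> bident_edges n. r $ j)"
    by (simp add: sum.inter_filter[symmetric])
  finally show ?thesis .
qed


text \<open>Ordering the endpoints removes the symmetry of unordered edges. If \<open>j = 2\<close>,
  then \<open>i\<close> is one of the two leaves 0 and 1.\<close>

lemma bident_edge_iff:
  assumes "3 \<le> n" "i < j"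
  shows "{i, j} \<in> bident_edges n \<longleftrightarrow> j = 2 \<or> 2 \<le> i \<and> j = i + 1 \<and> j < n"
proof
  assume "{i, j} \<in> bident_edges n"
  then show "j = 2 \<or> 2 \<le> i \<and> j = i + 1 \<and> j < n"
    using assms unfolding bident_edges_def by (auto simp: doubleton_eq_iff)
next
  assume *: "j = 2 \<or> 2 \<le> i \<and> j = i + 1 \<and> j < n"
  show "{i, j} \<in> bident_edges n"
  proof (cases "j = 2")
    case True
    then have "i = 0 \<or> i = 1" using assms by auto
    then show ?thesis using True unfolding bident_edges_def by auto
  next
    case False
    with * have "{i, j} = {vpath (i - 2), vpath (i - 2 + 1)}" "i - 2 + 1 \<le> n - 3" by auto
    then show ?thesis unfolding bident_edges_def by blast
  qed
qed

lemma bident_no_loop: "{i, i} \<notin> bident_edges n"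
  unfolding bident_edges_def by (auto simp: doubleton_eq_iff)

text \<open>The successor along the path is kept as a separate set, since it is missing at the last
  vertex; it becomes the \<open>vec_ext\<close> term of the kernel equations.\<close>

lemma bident_neighbours:
  assumes "3 \<le> n" "i < n"
  shows "{j. j < n \<and> {i, j} \<in> bident_edges n} =
    (if i < 2 then {2} else if i = 2 then {0, 1} else {i - 1}) \<union>
    (if 2 \<le> i \<and> i + 1 < n then {i + 1} else {})"
proof (rule Set.set_eqI)
  fix j
  consider "i = j" | "i < j" | "j < i" by linarith
  then show "j \<in> {j. j < n \<and> {i, j} \<in> bident_edges n} \<longleftrightarrow>
    j \<in> (if i < 2 then {2} else if i = 2 then {0, 1} else {i - 1}) \<union>
      (if 2 \<le> i \<and> i + 1 < n then {i + 1} else {})"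
  proof cases
    case 1
    then show ?thesis using bident_no_loop[of i n] by auto
  next
    case 2
    then show ?thesis using assms bident_edge_iff[OF assms(1) 2] by auto
  next
    case 3
    then have "{i, j} \<in> bident_edges n \<longleftrightarrow> i = 2 \<or> 2 \<le> j \<and> i = j + 1 \<and> i < n"
      using bident_edge_iff[OF assms(1) 3] by (simp add: insert_commute)
    then show ?thesis using assms 3 by auto
  qed
qed

text \<open>Zero padding stands in for the missing neighbour of the last vertex, so the equation
  there has the same form as at the other path vertices. The padding also matches the zeros that end
  a residue sequence.\<close>

definition vec_ext :: "int vec \<Rightarrow> nat \<Rightarrow> int" where
  "vec_ext r i = (if i < dim_vec r then r $ i else 0)"

lemma all_less_split_3:
  assumes "3 \<le> (n::nat)"
  shows "(\<forall>i<n. P i) \<longleftrightarrow> P 0 \<and> P 1 \<and> P 2 \<and> (\<forall>i. 3 \<le> i \<and> i < n \<longrightarrow> P i)"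
    (is "?L \<longleftrightarrow> ?R")
proof
  assume ?R
  show ?L
  proof (intro allI impI)
    fix i assume "i < n"
    consider "i = 0" | "i = 1" | "i = 2" | "3 \<le> i" by linarith
    then show "P i" using \<open>?R\<close> \<open>i < n\<close> by cases simp_all
  qed
qed (use assms in simp)

lemma bident_kernel_iff:
  assumes "3 \<le> n" "d \<in> carrier_vec n" "r \<in> carrier_vec n"
  shows "(mat_diag n (\<lambda>i. d $ i) - bident_adj n) *\<^sub>v r = 0\<^sub>v n \<longleftrightarrow>
    d $ 0 * r $ 0 = r $ 2 \<and> d $ 1 * r $ 1 = r $ 2 \<and>
    d $ 2 * r $ 2 = r $ 0 + r $ 1 + vec_ext r 3 \<and>
    (\<forall>i. 3 \<le> i \<and> i < n \<longrightarrow> d $ i * r $ i = r $ (i - 1) + vec_ext r (i + 1))"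
    (is "?L \<longleftrightarrow> ?R")
proof -
  define N where "N i = (\<Sum>j | j < n \<and> {i, j} \<in> bident_edges n. r $ j)" for i
  have dim: "dim_vec r = n" using assms by simp
  have N012: "N 0 = r $ 2" "N 1 = r $ 2" "N 2 = r $ 0 + r $ 1 + vec_ext r 3"
    using assms(1) dim bident_neighbours[of n 0] bident_neighbours[of n 1] bident_neighbours[of n 2]
    unfolding N_def vec_ext_def by simp_all
  define v where "v = (mat_diag n (\<lambda>i. d $ i) - bident_adj n) *\<^sub>v r"
  have "dim_vec v = n" unfolding v_def bident_adj_def by simp
  moreover have "v $ i = d $ i * r $ i - N i" if "i < n" for i
    unfolding v_def N_def by (rule mult_mat_vec_bident[OF assms that])
  ultimately have "v = 0\<^sub>v n \<longleftrightarrow> (\<forall>i<n. d $ i * r $ i = N i)"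
    by (simp add: vec_eq_iff)
  also have "\<dots> \<longleftrightarrow> (d $ 0 * r $ 0 = N 0 \<and> d $ 1 * r $ 1 = N 1 \<and> d $ 2 * r $ 2 = N 2 \<and>
      (\<forall>i. 3 \<le> i \<and> i < n \<longrightarrow> d $ i * r $ i = N i))"
    by (rule all_less_split_3[OF assms(1)])
  also have "(\<forall>i. 3 \<le> i \<and> i < n \<longrightarrow> d $ i * r $ i = N i) =
      (\<forall>i. 3 \<le> i \<and> i < n \<longrightarrow> d $ i * r $ i = r $ (i - 1) + vec_ext r (i + 1))"
  proof -
    have "N i = r $ (i - 1) + vec_ext r (i + 1)" if "3 \<le> i" "i < n" for i
      using assms(1) dim that bident_neighbours[of n i] unfolding N_def vec_ext_def by simp
    then show ?thesis by auto
  qed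
  finally show ?thesis unfolding N012 v_def .
qed

section \<open>Smooth structures with prescribed \<open>rbar\<close> as integer conditions\<close>

lemma rbar_index_eq_iff:
  assumes "3 \<le> dim_vec r" "0 < r $ 0" "0 < r $ 1"
  shows "rbar r $ vx = of_int a \<longleftrightarrow> r $ 2 = a * r $ 1"
    and "rbar r $ vy = of_int b \<longleftrightarrow> r $ 2 = b * r $ 0"
proof -
  \<comment> \<open>The scaling factor cancels the leaf's own entry and leaves the entry of the
    opposite leaf in the denominator.\<close>
  have "rbar r $ vx = of_int (r $ 2) / of_int (r $ 1)"
    "rbar r $ vy = of_int (r $ 2) / of_int (r $ 0)"
    using assms unfolding rbar_def by (auto simp: field_simps numeral_2_eq_2)
  moreover have "of_int (r $ 2) / of_int c = (of_int e :: rat) \<longleftrightarrow> r $ 2 = e * c"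
    if "0 < c" for c e
    using that by (simp add: field_simps flip: of_int_mult)
  ultimately show "rbar r $ vx = of_int a \<longleftrightarrow> r $ 2 = a * r $ 1"
    "rbar r $ vy = of_int b \<longleftrightarrow> r $ 2 = b * r $ 0" using assms by auto
qed

definition smooth_with_rbar :: "nat \<Rightarrow> int \<Rightarrow> int \<Rightarrow> int vec \<Rightarrow> int vec \<Rightarrow> bool" where
  "smooth_with_rbar n a b d r \<longleftrightarrow> smooth_bident_arith_structure n d r \<and>
     rbar r $ vx = of_int a \<and> rbar r $ vy = of_int b"

lemma smooth_with_rbar_iff:
  "smooth_with_rbar n a b d r \<longleftrightarrow>
    3 \<le> n \<and> d \<in> carrier_vec n \<and> r \<in> carrier_vec n \<and>
    (\<forall>i<n. 0 < d $ i) \<and> (\<forall>i<n. 0 < r $ i) \<and>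
    d $ 0 * r $ 0 = r $ 2 \<and> d $ 1 * r $ 1 = r $ 2 \<and>
    d $ 2 * r $ 2 = r $ 0 + r $ 1 + vec_ext r 3 \<and>
    (\<forall>i. 3 \<le> i \<and> i < n \<longrightarrow> d $ i * r $ i = r $ (i - 1) + vec_ext r (i + 1)) \<and>
    Gcd (vec_set r) = 1 \<and>
    2 \<le> d $ 0 \<and> 2 \<le> d $ 1 \<and> (\<forall>i. 3 \<le> i \<and> i < n \<longrightarrow> 2 \<le> d $ i) \<and>
    r $ 2 = a * r $ 1 \<and> r $ 2 = b * r $ 0"
\<comment> \<open>The rewriting of the kernel and \<open>rbar\<close> conditions is valid only under
  these assumptions; without them both sides are false.\<close>
proof (cases "3 \<le> n \<and> d \<in> carrier_vec n \<and> r \<in> carrier_vec n \<and> (\<forall>i<n. 0 < r $ i)")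
  case False
  then show ?thesis
    unfolding smooth_with_rbar_def smooth_bident_arith_structure_def bident_arith_structure_def
    by blast
next
  case True
  then have n: "3 \<le> n" "d \<in> carrier_vec n" "r \<in> carrier_vec n" by auto
  have pos: "0 < r $ 0" "0 < r $ 1" "3 \<le> dim_vec r" using True by auto
  have path: "(\<forall>i\<in>{1..n - 3}. 2 \<le> d $ vpath i) \<longleftrightarrow> (\<forall>i. 3 \<le> i \<and> i < n \<longrightarrow> 2 \<le> d $ i)"
    (is "?A \<longleftrightarrow> ?B")
  proof
    assume A: ?A
    show ?B
    proof (intro allI impI)
      fix i assume i: "3 \<le> i \<and> i < n"
      then have "vpath (i - 2) = i" by linarith
      moreover have "i - 2 \<in> {1..n - 3}" using i by auto
      ultimately show "2 \<le> d $ i" using A by metis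
    qed
  qed auto
  show ?thesis
    unfolding smooth_with_rbar_def smooth_bident_arith_structure_def bident_arith_structure_def
      bident_kernel_iff[OF n] rbar_index_eq_iff[OF pos(3,1,2)] path conj_assoc
    by (rule refl)
qed

text \<open>Comparing each leaf equation with the \<open>rbar\<close> condition at the opposite leaf
  identifies the leaf entries of \<open>d\<close> as \<open>b\<close> and \<open>a\<close>.
  Smoothness at the leaves then bounds \<open>a\<close> and \<open>b\<close> below by 2.\<close>

lemma smooth_with_rbarD:
  assumes "smooth_with_rbar n a b d r"
  shows "3 \<le> n" "dim_vec d = n" "dim_vec r = n" "Gcd (vec_set r) = 1"
    "d $ 0 = b" "d $ 1 = a" "2 \<le> a" "2 \<le> b" "r $ 2 = a * r $ 1" "r $ 2 = b * r $ 0"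
    "d $ 2 * r $ 2 = r $ 0 + r $ 1 + vec_ext r 3" "0 < r $ 0" "0 < r $ 1" "0 < r $ 2"
    "i < n \<Longrightarrow> 0 < d $ i" "i < n \<Longrightarrow> 0 < r $ i" "3 \<le> i \<Longrightarrow> i < n \<Longrightarrow> 2 \<le> d $ i"
    "3 \<le> i \<Longrightarrow> i < n \<Longrightarrow> d $ i * r $ i = r $ (i - 1) + vec_ext r (i + 1)"
proof -
  note smooth = assms[unfolded smooth_with_rbar_iff]
  show n: "3 \<le> n" "dim_vec d = n" "dim_vec r = n" "Gcd (vec_set r) = 1"
    and r: "r $ 2 = a * r $ 1" "r $ 2 = b * r $ 0"
    and "d $ 2 * r $ 2 = r $ 0 + r $ 1 + vec_ext r 3"
    using smooth by (blast intro: carrier_vecD)+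
  have "\<forall>i<n. 0 < r $ i" using smooth by blast
  then show pos: "0 < r $ 0" "0 < r $ 1" "0 < r $ 2" 
    using \<open>\<forall>i<n. 0 < r $ i\<close> n(1) by simp_all
  show "i < n \<Longrightarrow> 0 < d $ i" "i < n \<Longrightarrow> 0 < r $ i" "3 \<le> i \<Longrightarrow> i < n \<Longrightarrow> 2 \<le> d $ i"
    "3 \<le> i \<Longrightarrow> i < n \<Longrightarrow> d $ i * r $ i = r $ (i - 1) + vec_ext r (i + 1)"
    using smooth by blast+
  have eq: "d $ 0 * r $ 0 = r $ 2" "d $ 1 * r $ 1 = r $ 2" and ge: "2 \<le> d $ 0" "2 \<le> d $ 1"
    using smooth by blast+
  show d: "d $ 0 = b" using eq(1) pos(1) unfolding r(2) by simp
  show d': "d $ 1 = a" using eq(2) pos(2) unfolding r(1) by simp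
  show "2 \<le> a" "2 \<le> b" using ge d d' by simp_all
qed

section \<open>Smooth structures follow the residue sequence\<close>

lemma smooth_path_decreasing:
  assumes "smooth_with_rbar n a b d r" "2 \<le> i" "i < n"
  shows "vec_ext r (i + 1) < r $ i"
  using assms(2,3)
\<comment> \<open>Downwards from the end of the path: the padding lies below the last entry, and
  \<open>d \<ge> 2\<close> makes the entries convex, so the decrease propagates towards the
  centre.\<close>
proof (induction "n - i" arbitrary: i rule: less_induct)
  case less
  note smooth = smooth_with_rbarD[OF assms(1)]
  have dim: "dim_vec r = n" using smooth by auto
  show ?case
  proof (cases "i + 1 < n")
    case False
    then show ?thesis using smooth(16)[of i] less.prems dim unfolding vec_ext_def by simp
  next
    case True
    then have "vec_ext r (i + 1 + 1) < r $ (i + 1)" using less by simp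
    moreover have "d $ (i + 1) * r $ (i + 1) = r $ i + vec_ext r (i + 1 + 1)"
      using smooth(18)[of "i + 1"] less.prems True by simp
    moreover have "2 * r $ (i + 1) \<le> d $ (i + 1) * r $ (i + 1)"
      using smooth(16,17)[of "i + 1"] less.prems True by (intro mult_right_mono) auto
    ultimately have "r $ (i + 1) < r $ i" by linarith
    then show ?thesis using True dim unfolding vec_ext_def by simp
  qed
qed

text \<open>These are the entries that \<open>rbar\<close> is forced to have: the two leaves, then
  along the path the residue sequence, shifted by two indices.\<close>

definition rbar_seq :: "int \<Rightarrow> int \<Rightarrow> nat \<Rightarrow> int" where
  "rbar_seq a b i = (if i = 0 then a else if i = 1 then b
     else residue_seq (a * b) (a * b - a - b) (i - 2))"

lemma vec_ext_nonneg:
  assumes "smooth_with_rbar n a b d r"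
  shows "0 \<le> vec_ext r i" "0 < vec_ext r i \<longleftrightarrow> i < n"
  using smooth_with_rbarD(3)[OF assms] smooth_with_rbarD(16)[OF assms, of i]
  unfolding vec_ext_def by (cases "i < n"; simp)+

text \<open>Cross-multiplying keeps the comparison of \<open>rbar\<close> with the residue sequence
  within the integers. Each scaled entry is nonnegative and below its predecessor, hence is the
  residue that the vertex equation prescribes.\<close>

lemma smooth_path_proportional:
  assumes "smooth_with_rbar n a b d r"
  shows "r $ 2 * vec_ext r (i + 2)
    = r $ 0 * r $ 1 * residue_seq (a * b) (a * b - a - b) i"
proof (induction i rule: induct_nat_012)
  case 0
  note smooth = smooth_with_rbarD[OF assms]
  have "dim_vec r = n" using smooth by auto
  then have "vec_ext r 2 = r $ 2" using smooth unfolding vec_ext_def by simp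
  moreover have "r $ 2 * r $ 2 = (a * r $ 1) * (b * r $ 0)" using smooth by metis
  ultimately show ?case by (simp add: algebra_simps numeral_2_eq_2)
next
  case 1
  note smooth = smooth_with_rbarD[OF assms]
  have ab: "2 \<le> a" "2 \<le> b" and n: "3 \<le> n" using smooth by auto
  have K: "0 < r $ 0 * r $ 1" "0 < r $ 2" using smooth by auto
  have sq: "r $ 2 * r $ 2 = r $ 0 * r $ 1 * (a * b)"
  proof -
    have "r $ 2 * r $ 2 = (a * r $ 1) * (b * r $ 0)" using smooth by metis
    then show ?thesis by (simp add: algebra_simps)
  qed
  have eq: "r $ 2 * vec_ext r 3 = r $ 0 * r $ 1 * (d $ 2 * (a * b) - a - b)"
  proof -
    have "vec_ext r 3 = d $ 2 * r $ 2 - r $ 0 - r $ 1" using smooth by simp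
    then have "r $ 2 * vec_ext r 3 = d $ 2 * (r $ 2 * r $ 2) - r $ 2 * r $ 0 - r $ 2 * r $ 1"
      by (simp only:) (simp add: algebra_simps)
    moreover have "r $ 2 * r $ 0 = a * r $ 1 * r $ 0" "r $ 2 * r $ 1 = b * r $ 0 * r $ 1"
      using smooth by metis+
    ultimately have "r $ 2 * vec_ext r 3 = d $ 2 * (r $ 0 * r $ 1 * (a * b))
        - a * r $ 1 * r $ 0 - b * r $ 0 * r $ 1" unfolding sq by (simp only:)
    then show ?thesis by (simp only:) (simp add: algebra_simps)
  qed
  \<comment> \<open>The decrease after the centre, combined with \<open>a + b \<le> a * b\<close>,
    leaves \<open>d $ 2 = 1\<close> as the only possibility.\<close>
  have "r $ 2 * vec_ext r 3 < r $ 2 * r $ 2"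
    using smooth_path_decreasing[OF assms, of 2] n K by simp
  then have "d $ 2 * (a * b) - a - b < a * b" 
    unfolding eq sq mult_less_cancel_left_pos[OF K(1)] .
  then have "d $ 2 * (a * b) < 2 * (a * b)" using add_le_mult_int[OF ab] by linarith
  then have "d $ 2 < 2" using ab by (simp add: mult_less_cancel_right)
  moreover have "0 < d $ 2" using smooth(15) n by simp
  ultimately have "d $ 2 = 1" by linarith
  then show ?case using eq by (simp add: numeral_3_eq_3 numeral_2_eq_2)
next
  case (ge2 i)
  note smooth = smooth_with_rbarD[OF assms]
  let ?S = "residue_seq (a * b) (a * b - a - b)"
  have K: "0 < r $ 0 * r $ 1" "0 < r $ 2" using smooth by auto
  have dim: "dim_vec r = n" using smooth by auto
  have IH: "r $ 2 * vec_ext r (i + 3) = r $ 0 * r $ 1 * ?S (Suc i)"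
    "r $ 2 * vec_ext r (i + 2) = r $ 0 * r $ 1 * ?S i"
    using ge2 by (simp_all add: numeral_3_eq_3 numeral_2_eq_2)
  show ?case
  proof (cases "i + 3 < n")
    case True
    then have "0 < r $ 2 * vec_ext r (i + 3)" using K vec_ext_nonneg[OF assms] by simp
    then have pos: "0 < ?S (Suc i)"
      unfolding IH using mult_less_cancel_left_pos[OF K(1), of 0] by simp
    have ext: "vec_ext r (i + 2) = r $ (i + 2)" "vec_ext r (i + 3) = r $ (i + 3)"
      using True dim unfolding vec_ext_def by auto
    have "d $ (i + 3) * r $ (i + 3) = r $ (i + 3 - 1) + vec_ext r (i + 3 + 1)"
      using smooth(18) True by simp
    then have "vec_ext r (i + 4) = d $ (i + 3) * vec_ext r (i + 3) - vec_ext r (i + 2)"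
      unfolding ext by (simp add: numeral_eq_Suc)
    then have "r $ 2 * vec_ext r (i + 4)
        = d $ (i + 3) * (r $ 2 * vec_ext r (i + 3)) - r $ 2 * vec_ext r (i + 2)"
      by (simp only:) (simp add: algebra_simps)
    then have eq: "r $ 2 * vec_ext r (i + 4)
        = r $ 0 * r $ 1 * (d $ (i + 3) * ?S (Suc i) - ?S i)"
      unfolding IH by (simp add: algebra_simps)
    have "0 \<le> r $ 2 * vec_ext r (i + 4)" using K vec_ext_nonneg[OF assms] by simp
    then have "0 \<le> d $ (i + 3) * ?S (Suc i) - ?S i"
      unfolding eq using mult_le_cancel_left_pos[OF K(1), of 0] by simp
    moreover have "r $ 2 * vec_ext r (i + 4) < r $ 2 * vec_ext r (i + 3)"
      unfolding ext using smooth_path_decreasing[OF assms, of "i + 3"] True K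
      by (simp add: numeral_eq_Suc)
    then have "d $ (i + 3) * ?S (Suc i) - ?S i < ?S (Suc i)"
      unfolding eq IH mult_less_cancel_left_pos[OF K(1)] .
    \<comment> \<open>The value lies in the residue range modulo the preceding term, and modulo that
      term the multiple with factor \<open>d $ (i + 3)\<close> vanishes.\<close>
    ultimately have "d $ (i + 3) * ?S (Suc i) - ?S i
        = (d $ (i + 3) * ?S (Suc i) - ?S i) mod ?S (Suc i)" by simp
    also have "\<dots> = (- ?S i) mod ?S (Suc i)"
      using mod_mult_self3[of "d $ (i + 3)" "?S (Suc i)" "- ?S i"] by simp
    finally show ?thesis using eq pos by (simp add: numeral_eq_Suc)
  \<comment> \<open>Beyond the last vertex the padding forces a zero term, after which the residue
    sequence is continued by zeros as well.\<close>
  next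
    case False
    then have "vec_ext r (i + 3) = 0" "vec_ext r (i + 4) = 0"
      using dim unfolding vec_ext_def by auto
    moreover from this have "?S (Suc i) = 0" using IH(1) K(1) by auto
    ultimately show ?thesis by (simp add: numeral_eq_Suc)
  qed
qed

lemma smooth_proportional:
  assumes "smooth_with_rbar n a b d r"
  shows "r $ 2 * vec_ext r i = r $ 0 * r $ 1 * rbar_seq a b i"
proof -
  note smooth = smooth_with_rbarD[OF assms]
  have dim: "dim_vec r = n" "3 \<le> n" using smooth by auto
  have eq: "r $ 2 = a * r $ 1" "r $ 2 = b * r $ 0" using smooth by auto
  consider "i = 0" | "i = 1" | "2 \<le> i" by linarith
  then show ?thesis
  proof cases
    case 1
    then show ?thesis using dim eq(1) unfolding vec_ext_def rbar_seq_def by (simp add: algebra_simps)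
  next
    case 2
    then show ?thesis using dim eq(2) unfolding vec_ext_def rbar_seq_def by (simp add: algebra_simps)
  next
    case 3
    then have "i - 2 + 2 = i" "i \<noteq> 0" "i \<noteq> 1" by auto
    then show ?thesis using smooth_path_proportional[OF assms, of "i - 2"]
      unfolding rbar_seq_def by simp
  qed
qed

text \<open>By proportionality the positive residue terms correspond exactly to the vertices from
  the centre onwards; the two leaves account for the summand 2.\<close>

lemma smooth_imp_size:
  assumes "smooth_with_rbar n a b d r"
  shows "n = F (a * b) (a * b - a - b) + 2"
proof -
  note smooth = smooth_with_rbarD[OF assms]
  let ?S = "residue_seq (a * b) (a * b - a - b)"
  have ab: "2 \<le> a" "2 \<le> b" and n: "3 \<le> n" using smooth by auto
  have K: "0 < r $ 0 * r $ 1" "0 < r $ 2" using smooth by auto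
  have "i < F (a * b) (a * b - a - b) \<longleftrightarrow> i + 2 < n" for i
  proof -
    have "i < F (a * b) (a * b - a - b) \<longleftrightarrow> 0 < ?S i"
      using residue_seq_pos_iff[of "a * b"] ab add_le_mult_int[OF ab] by simp
    also have "\<dots> \<longleftrightarrow> 0 < r $ 0 * r $ 1 * ?S i"
      using mult_less_cancel_left_pos[OF K(1), of 0 "?S i"] by simp
    also have "\<dots> \<longleftrightarrow> i + 2 < n"
      unfolding smooth_path_proportional[OF assms, symmetric]
      using K(2) vec_ext_nonneg[OF assms] by (simp add: zero_less_mult_iff)
    finally show ?thesis .
  qed
  \<comment> \<open>The two instances give \<open>F \<le> n - 2\<close> and \<open>n - 3 < F\<close>
    for this value of \<open>F\<close>.\<close>
  from this[of "n - 2"] this[of "n - 3"] n show ?thesis by linarith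
qed

section \<open>Uniqueness from primitivity\<close>

lemma vec_set_smult_Gcd:
  assumes "0 < (c::int)"
  shows "Gcd (vec_set (c \<cdot>\<^sub>v r)) = c * Gcd (vec_set r)"
proof -
  have "vec_set (c \<cdot>\<^sub>v r) = (*) c ` vec_set r" by (auto simp: vec_set_def)
  then show ?thesis using assms by (simp add: Gcd_mult normalize_mult)
qed

text \<open>Both vectors are proportional to \<open>rbar_seq a b\<close>, hence to each other, and
  primitivity makes the factors \<open>\<alpha>\<close> and \<open>\<beta>\<close> equal. The vertex
  equations then determine \<open>d\<close>, as the entries of \<open>r\<close> are
  positive.\<close>

lemma smooth_unique:
  assumes "smooth_with_rbar n a b d r" "smooth_with_rbar n a b d' r'"
  shows "d = d' \<and> r = r'"
proof
  note smooth = smooth_with_rbarD[OF assms(1)]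
  note smooth' = smooth_with_rbarD[OF assms(2)]
  define \<alpha> \<beta> where "\<alpha> = r' $ 0 * r' $ 1 * r $ 2" and "\<beta> = r $ 0 * r $ 1 * r' $ 2"
  have pos: "0 < \<alpha>" "0 < \<beta>" unfolding \<alpha>_def \<beta>_def using smooth smooth' by auto
  have dim: "dim_vec r = n" "dim_vec r' = n" using smooth smooth' by auto
  have "\<alpha> * r $ i = \<beta> * r' $ i" if "i < n" for i
  proof -
    have "\<alpha> * vec_ext r i = r' $ 0 * r' $ 1 * (r $ 2 * vec_ext r i)"
      unfolding \<alpha>_def by (simp add: algebra_simps)
    also have "\<dots> = r $ 0 * r $ 1 * (r' $ 0 * r' $ 1 * rbar_seq a b i)"
      unfolding smooth_proportional[OF assms(1)] by (simp add: algebra_simps)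
    also have "\<dots> = \<beta> * vec_ext r' i"
      unfolding smooth_proportional[OF assms(2), symmetric] \<beta>_def by (simp add: algebra_simps)
    finally show ?thesis using that dim unfolding vec_ext_def by simp
  qed
  then have *: "\<alpha> \<cdot>\<^sub>v r = \<beta> \<cdot>\<^sub>v r'" using dim by (intro eq_vecI) auto
  then have "Gcd (vec_set (\<alpha> \<cdot>\<^sub>v r)) = Gcd (vec_set (\<beta> \<cdot>\<^sub>v r'))" by simp
  then have "\<alpha> = \<beta>" using pos smooth smooth' by (simp add: vec_set_smult_Gcd)
  have r: "r $ i = r' $ i" if "i < n" for i
  proof -
    have "(\<alpha> \<cdot>\<^sub>v r) $ i = (\<beta> \<cdot>\<^sub>v r') $ i" using * by simp
    then show ?thesis using that dim pos \<open>\<alpha> = \<beta>\<close> by simp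
  qed
  then show "r = r'" using dim by (intro eq_vecI) auto
  show "d = d'"
  proof (rule eq_vecI)
    fix i assume "i < dim_vec d'"
    then have i: "i < n" using smooth' by auto
    have "0 < r $ i" using smooth(16) i by blast
    consider "i = 0" | "i = 1" | "i = 2" | "3 \<le> i" by linarith
    then show "d $ i = d' $ i"
    proof cases
      case 1 then show ?thesis using smooth smooth' by simp
    next
      case 2 then show ?thesis using smooth smooth' by simp
    next
      case 3
      then have "d $ i * r $ i = d' $ i * r $ i" using smooth(11) smooth'(11) \<open>r = r'\<close> by simp
      then show ?thesis using \<open>0 < r $ i\<close> by simp
    next
      case 4
      then have "d $ i * r $ i = d' $ i * r $ i" using i smooth(18)[of i] smooth'(18)[of i] \<open>r = r'\<close> by simp
      then show ?thesis using \<open>0 < r $ i\<close> by simp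
    qed
  qed (use smooth smooth' in auto)
qed

section \<open>Construction of the structure\<close>

lemma residue_seq_nonneg: "0 \<le> x \<Longrightarrow> 0 \<le> y \<Longrightarrow> 0 \<le> residue_seq x y i"
  by (induction x y i rule: residue_seq.induct) auto

text \<open>The hypothesis \<open>y < x\<close> covers the first step; every later step takes a
  residue modulo the current term.\<close>

lemma residue_seq_Suc_less:
  assumes "y < x" "0 < residue_seq x y i"
  shows "residue_seq x y (Suc i) < residue_seq x y i"
  using assms by (cases i) auto

text \<open>The vector \<open>r\<close> is \<open>rbar_seq a b\<close> divided by its gcd. On the
  path, the residue congruence makes \<open>d\<close> integral, and the decrease of the sequence
  gives \<open>d \<ge> 2\<close>.\<close>

lemma smooth_exists:
  assumes ab: "2 \<le> a" "2 \<le> b"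
  defines "n \<equiv> F (a * b) (a * b - a - b) + 2"
  shows "\<exists>d r. smooth_with_rbar n a b d r"
proof -
  let ?S = "residue_seq (a * b) (a * b - a - b)"
  let ?T = "rbar_seq a b"
  have s: "a + b \<le> a * b" using add_le_mult_int ab by blast
  have S_pos: "0 < ?S i \<longleftrightarrow> i + 2 < n" for i
    using residue_seq_pos_iff[of "a * b" "a * b - a - b" i] s ab by (simp add: n_def)
  have S_nonneg: "0 \<le> ?S i" for i
    using residue_seq_nonneg[of "a * b" "a * b - a - b" i] s ab(1,2) by simp
  have n: "3 \<le> n" using S_pos[of 0] ab by auto
  have T_pos: "0 < ?T i" if "i < n" for i
    using S_pos[of "i - 2"] that ab unfolding rbar_seq_def by auto
  have T_n: "?T n = 0" using S_pos[of "n - 2"] S_nonneg[of "n - 2"] n unfolding rbar_seq_def by auto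
  have T_dvd: "?T i dvd ?T (i - 1) + ?T (i + 1)" if "3 \<le> i" "i < n" for i
  proof -
    define k where "k = i - 3"
    have k: "i = k + 3" using that(1) unfolding k_def by simp
    have "0 < ?S (Suc k)" using S_pos[of "Suc k"] that k by simp
    then have "?S (Suc (Suc k)) = (- ?S k) mod ?S (Suc k)" by simp
    then have "(?S k + ?S (Suc (Suc k))) mod ?S (Suc k) = 0"
      using mod_add_right_eq[of "?S k" "- ?S k" "?S (Suc k)"] by (simp only: add.right_inverse mod_0)
    then have "?S (Suc k) dvd ?S k + ?S (Suc (Suc k))" by (rule mod_0_imp_dvd)
    then show ?thesis unfolding rbar_seq_def k
      by (simp add: numeral_eq_Suc del: residue_seq.simps)
  qed
  have T_less: "?T i < ?T (i - 1)" if "3 \<le> i" "i < n" for i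
  proof -
    define k where "k = i - 3"
    have k: "i = k + 3" using that(1) unfolding k_def by simp
    have "?S (Suc k) < ?S k"
      using residue_seq_Suc_less[of "a * b - a - b" "a * b" k] S_pos[of k] that k ab by simp
    then show ?thesis unfolding rbar_seq_def k
      by (simp add: numeral_eq_Suc del: residue_seq.simps)
  qed
  \<comment> \<open>All entries are solved from the vertex equations. The leaves swap
    \<open>a\<close> and \<open>b\<close> since the centre carries \<open>a * b\<close>, and the
    centre gets 1 since \<open>a + b + (a * b - a - b) = a * b\<close>.\<close>
  define d where "d = vec n (\<lambda>i. if i = 0 then b else if i = 1 then a else if i = 2 then 1
    else (?T (i - 1) + ?T (i + 1)) div ?T i)"
  define g where "g = Gcd (vec_set (vec n ?T))"
  define r where "r = vec n (\<lambda>i. ?T i div g)"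
  have g_dvd: "g dvd ?T i" if "i < n" for i
    unfolding g_def using that by (intro Gcd_dvd) (auto simp: vec_set_def)
  have "g \<noteq> 0" using g_dvd[of 0] T_pos[of 0] n by auto
  moreover have "0 \<le> g" unfolding g_def by (rule Gcd_int_greater_eq_0)
  ultimately have g: "0 < g" by simp
  have gr: "g * r $ i = ?T i" if "i < n" for i using that g_dvd unfolding r_def by simp
  \<comment> \<open>The index \<open>n\<close> is included for the equation at the last vertex:
    there the padding meets the first zero of the sequence.\<close>
  have gext: "g * vec_ext r i = ?T i" if "i \<le> n" for i
    using that gr T_n by (cases "i = n") (auto simp: vec_ext_def r_def)
  have T: "?T 0 = a" "?T 1 = b" "?T 2 = a * b" "?T 3 = a * b - a - b"
    unfolding rbar_seq_def by (simp_all add: numeral_3_eq_3)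
  have d_path: "d $ i * ?T i = ?T (i - 1) + ?T (i + 1)" if "3 \<le> i" "i < n" for i
    using T_dvd[OF that] that unfolding d_def by simp
  have d_ge: "2 \<le> d $ i" if "3 \<le> i" "i < n" for i
  proof -
    have "0 \<le> ?T (i + 1)" using S_nonneg that unfolding rbar_seq_def by simp
    then have "1 * ?T i < d $ i * ?T i" using d_path[OF that] T_less[OF that] by simp
    then have "1 < d $ i" using T_pos[OF that(2)] mult_less_cancel_right_pos by blast
    then show ?thesis by simp
  qed
  have "smooth_with_rbar n a b d r"
    unfolding smooth_with_rbar_iff
  proof (intro conjI allI impI)
    show "0 < r $ i" if "i < n" for i
      using gr[OF that] T_pos[OF that] g by (metis zero_less_mult_pos)
    show "Gcd (vec_set r) = 1"
    proof -
      have "vec n ?T = g \<cdot>\<^sub>v r" using gr by (intro eq_vecI) (auto simp: r_def)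
      then have "g = g * Gcd (vec_set r)" using vec_set_smult_Gcd[OF g, of r] g_def by simp
      then show ?thesis using g by simp
    qed
    show "0 < d $ i" if "i < n" for i
      using that ab d_ge[of i] by (cases "3 \<le> i") (auto simp: d_def)
    have "g * r $ 2 = g * (a * r $ 1)" "g * r $ 2 = g * (b * r $ 0)"
      using gr[of 0] gr[of 1] gr[of 2] n T by (simp_all add: mult.left_commute)
    then show r2: "r $ 2 = a * r $ 1" "r $ 2 = b * r $ 0" using g by simp_all
    have d01: "d $ 0 = b" "d $ 1 = a" using n unfolding d_def by simp_all
    show "d $ 0 * r $ 0 = r $ 2" using r2(2) d01(1) by simp
    show "d $ 1 * r $ 1 = r $ 2" using r2(1) d01(2) by simp
    show "2 \<le> d $ 0" "2 \<le> d $ 1" using ab d01 by simp_all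
    have "d $ 2 = 1" using n unfolding d_def by simp
    moreover have "g * r $ 2 = g * (r $ 0 + r $ 1 + vec_ext r 3)"
      using gr[of 0] gr[of 1] gr[of 2] gext[of 3] n T by (simp add: distrib_left)
    ultimately show "d $ 2 * r $ 2 = r $ 0 + r $ 1 + vec_ext r 3" using g by simp
    show "d $ i * r $ i = r $ (i - 1) + vec_ext r (i + 1)" if "3 \<le> i \<and> i < n" for i
    proof -
      have "i - 1 < n" "i + 1 \<le> n" using that by auto
      then have "g * (d $ i * r $ i) = g * (r $ (i - 1) + vec_ext r (i + 1))"
        using gr[of i] gr[of "i - 1"] gext[of "i + 1"] that d_path[of i]
        by (simp add: distrib_left mult.left_commute[of g "d $ i"])
      then show ?thesis using g by simp
    qed
    show "2 \<le> d $ i" if "3 \<le> i \<and> i < n" for i using d_ge that by blast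
  qed (use n ab in \<open>auto simp: d_def r_def\<close>)
  then show ?thesis by blast
qed

theorem theorem3p3:
  fixes a b t \<epsilon> :: int
  assumes "a \<ge> 2" and "b \<ge> 2"
    and "a + b = t * b\<^sup>2 + \<epsilon>" and "t \<ge> 0" and "0 \<le> \<epsilon>" and "\<epsilon> \<le> b\<^sup>2 - 1"
  shows "\<forall>n::nat.
    (int n = int (F (b\<^sup>2) \<epsilon>) + t + \<lfloor>(of_int (a * b) :: rat) / of_int (a + b)\<rfloor> \<longrightarrow>
      (\<exists>!(d, r). smooth_bident_arith_structure n d r \<and>
         rbar r $ vx = of_int a \<and> rbar r $ vy = of_int b)) \<and>
    (int n \<noteq> int (F (b\<^sup>2) \<epsilon>) + t + \<lfloor>(of_int (a * b) :: rat) / of_int (a + b)\<rfloor> \<longrightarrow>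
      \<not> (\<exists>d r. smooth_bident_arith_structure n d r \<and>
         rbar r $ vx = of_int a \<and> rbar r $ vy = of_int b))"
proof -
  have "a + b = \<epsilon> + int (nat t) * b\<^sup>2" using assms by simp
  then have "F (b\<^sup>2) (a + b) = F (b\<^sup>2) \<epsilon> + nat t"
    using F_add_mult_right[of "b\<^sup>2" \<epsilon> "nat t"] assms by (simp add: add.commute)
  \<comment> \<open>The rational floor is an integer division, so the claimed size becomes the
    number of positive residue terms plus the two leaves.\<close>
  then have size: "int (F (b\<^sup>2) \<epsilon>) + t + \<lfloor>(of_int (a * b) :: rat) / of_int (a + b)\<rfloor>
      = int (F (a * b) (a * b - a - b) + 2)"
    using F_mult_diff_add[OF assms(1,2)] assms(4)
      floor_divide_of_int_eq[of "a * b" "a + b", where ?'a = rat]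
    by simp
  have "\<exists>!(d, r). smooth_with_rbar n a b d r" if "n = F (a * b) (a * b - a - b) + 2" for n
    using smooth_exists[OF assms(1,2)] smooth_unique that by (auto simp: Ex1_def) blast+
  moreover have "\<not> (\<exists>d r. smooth_with_rbar n a b d r)"
    if "n \<noteq> F (a * b) (a * b - a - b) + 2" for n
    using smooth_imp_size that by blast
  ultimately show ?thesis
    unfolding size of_nat_eq_iff smooth_with_rbar_def by simp
qed

end
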